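(* Suppose that for every integer $n \geq 3$ and every convex polygon $P \subset \mathbb{R}^2$ with $n$ vertices, the slack matrix $S_P$ satisfies $\operatorname{rank}_+(S_P) \leq \left\lfloor \frac{n+6}{2} \right\rfloor$. Then every nonnegative matrix $X \in \mathbb{R}^{m \times n}_+$ with $\operatorname{rank}(X) = 3$ satisfies \[ \operatorname{rank}_+(X) \; \leq \; \left\lfloor \frac{\min(m,n)+6}{2} \right\rfloor . \]
   Context: For a nonnegative matrix $X \in \mathbb{R}^{m\times n}_+$, the nonnegative rank $\operatorname{rank}_+(X)$ is the smallest integer $r$ such that there exist $W \in \mathbb{R}^{m\times r}_+$ and $H \in \mathbb{R}^{r\times n}_+$ with $X = WH$. The slack matrix of a polytope $P = \{x \in \mathbb{R}^k : A(i,:)x \leq b_i,\ 1\le i\le m\}$ (facet description with $m$ facets) with vertices $v_1,\dots,v_n$ is the $m\times n$ nonnegative matrix with entries $b_i - A(i,:)v_j$ (the slack of vertex $j$ with respect to facet $i$). $\lfloor x \rfloor$ denotes the largest integer not exceeding $x$. *)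

theory Defs
  imports "HOL-Analysis.Analysis" "Jordan_Normal_Form.DL_Rank"
begin

definition nonneg_mat :: "real mat \<Rightarrow> bool" where
  "nonneg_mat X \<longleftrightarrow> (\<forall>i<dim_row X. \<forall>j<dim_col X. X $$ (i, j) \<ge> 0)"

definition nonneg_rank :: "real mat \<Rightarrow> nat" where
  "nonneg_rank X = (LEAST r. \<exists>W H. W \<in> carrier_mat (dim_row X) r \<and> H \<in> carrier_mat r (dim_col X)
       \<and> nonneg_mat W \<and> nonneg_mat H \<and> X = W * H)"

definition real_rank :: "real mat \<Rightarrow> nat" where
  "real_rank X = vec_space.rank (dim_row X) X"

definition convex_polygon_vertices :: "nat \<Rightarrow> (nat \<Rightarrow> real^2) \<Rightarrow> bool" where
  "convex_polygon_vertices n v \<longleftrightarrow> inj_on v {..<n} \<and>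
     (\<forall>j<n. v j extreme_point_of (convex hull (v ` {..<n})))"

definition facet_description :: "(real^2) set \<Rightarrow> nat \<Rightarrow> (nat \<Rightarrow> real^2) \<Rightarrow> (nat \<Rightarrow> real) \<Rightarrow> bool" where
  "facet_description P m a b \<longleftrightarrow>
     P = {x. \<forall>i<m. a i \<bullet> x \<le> b i} \<and>
     (\<forall>i<m. {x \<in> P. a i \<bullet> x = b i} facet_of P) \<and>
     inj_on (\<lambda>i. {x \<in> P. a i \<bullet> x = b i}) {..<m}"

definition slack_matrix :: "nat \<Rightarrow> nat \<Rightarrow> (nat \<Rightarrow> real^2) \<Rightarrow> (nat \<Rightarrow> real) \<Rightarrow> (nat \<Rightarrow> real^2) \<Rightarrow> real mat" where
  "slack_matrix m n a b v = Matrix.mat m n (\<lambda>(i, j). b i - a i \<bullet> v j)"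

end

theory Submission
  imports Defs
begin

text \<open>
  A nonnegative matrix of rank 3 factors as \<open>X = U V\<close> with inner dimension 3. Dividing each
  column by its (nonnegative) column sum, which is a linear form in the columns of \<open>V\<close>, one
  writes \<open>X\<^sub>r\<^sub>j = \<sigma>\<^sub>j f\<^sub>r(p\<^sub>j)\<close> with points \<open>p\<^sub>j \<in> \<real>\<^sup>2\<close>, affine functions \<open>f\<^sub>r\<close> and
  \<open>\<sigma>\<^sub>j \<ge> 0\<close>. Each \<open>f\<^sub>r\<close> is nonnegative on the polygon \<open>P\<close> spanned by the points with
  \<open>\<sigma>\<^sub>j > 0\<close>, so writing these points as convex combinations of the \<open>k \<le> n\<close> vertices of \<open>P\<close>
  gives \<open>X = N C\<close> with \<open>N\<^sub>r\<^sub>t = f\<^sub>r(v\<^sub>t)\<close> and \<open>C \<ge> 0\<close>. By the affine Farkas lemma each \<open>f\<^sub>r\<close> is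
  a nonnegative combination of the facet slacks of \<open>P\<close>, i.e. \<open>N = L S\<^sub>P\<close> with \<open>L \<ge> 0\<close>. Hence
  \<open>rank\<^sub>+ X \<le> rank\<^sub>+ S\<^sub>P\<close>, which the hypothesis bounds by \<open>\<lfloor>(k+6)/2\<rfloor> \<le> \<lfloor>(n+6)/2\<rfloor>\<close>;
  transposing gives the bound in terms of \<open>m\<close>.
\<close>

section \<open>Nonnegative rank\<close>

lemma index_mult_mat_sum:
  fixes A B :: "'a::comm_semiring_0 mat"
  assumes "A \<in> carrier_mat m k" "B \<in> carrier_mat k n" "i < m" "j < n"
  shows "(A * B) $$ (i, j) = (\<Sum>l<k. A $$ (i, l) * B $$ (l, j))"
  using assms by (auto simp: scalar_prod_def atLeast0LessThan intro!: sum.cong)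

lemma nonneg_mat_mult:
  assumes "A \<in> carrier_mat m k" "B \<in> carrier_mat k n" "nonneg_mat A" "nonneg_mat B"
  shows "nonneg_mat (A * B)"
  unfolding nonneg_mat_def
proof (intro allI impI)
  fix i j assume "i < dim_row (A * B)" "j < dim_col (A * B)"
  then have ij: "i < m" "j < n" using assms by auto
  show "0 \<le> (A * B) $$ (i, j)"
    unfolding index_mult_mat_sum[OF assms(1,2) ij]
    using assms ij by (intro sum_nonneg mult_nonneg_nonneg) (auto simp: nonneg_mat_def)
qed

lemma nonneg_mat_transpose [simp]: "nonneg_mat (transpose_mat X) \<longleftrightarrow> nonneg_mat X"
  by (auto simp: nonneg_mat_def)

lemma nonneg_rank_le:
  assumes "W \<in> carrier_mat (dim_row X) r" "H \<in> carrier_mat r (dim_col X)"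
    "nonneg_mat W" "nonneg_mat H" "X = W * H"
  shows "nonneg_rank X \<le> r"
  unfolding nonneg_rank_def by (rule Least_le) (use assms in blast)

lemma nonneg_rank_factorization:
  assumes "nonneg_mat X"
  obtains W H where "W \<in> carrier_mat (dim_row X) (nonneg_rank X)"
    "H \<in> carrier_mat (nonneg_rank X) (dim_col X)" "nonneg_mat W" "nonneg_mat H" "X = W * H"
proof -
  have "\<exists>r W H. W \<in> carrier_mat (dim_row X) r \<and> H \<in> carrier_mat r (dim_col X) \<and>
      nonneg_mat W \<and> nonneg_mat H \<and> X = W * H"
    using assms by (intro exI[of _ "dim_col X"] exI[of _ X] exI[of _ "1\<^sub>m (dim_col X)"])
      (auto simp: nonneg_mat_def)
  from LeastI_ex[OF this] show ?thesis
    using that unfolding nonneg_rank_def by blast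
qed

lemma nonneg_rank_mult_right_le:
  assumes "Y \<in> carrier_mat m p" "B \<in> carrier_mat p n" "nonneg_mat Y" "nonneg_mat B"
  shows "nonneg_rank (Y * B) \<le> nonneg_rank Y"
proof -
  obtain W H where WH: "W \<in> carrier_mat m (nonneg_rank Y)" "H \<in> carrier_mat (nonneg_rank Y) p"
    "nonneg_mat W" "nonneg_mat H" "Y = W * H"
    using assms(1) by (metis nonneg_rank_factorization[OF assms(3)] carrier_matD)
  have "Y * B = W * (H * B)" using WH assms(2) by (simp add: assoc_mult_mat)
  with WH assms show ?thesis
    by (intro nonneg_rank_le[of W _ _ "H * B"] nonneg_mat_mult) auto
qed

lemma nonneg_rank_mult_left_le:
  assumes "A \<in> carrier_mat m p" "Y \<in> carrier_mat p n" "nonneg_mat A" "nonneg_mat Y"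
  shows "nonneg_rank (A * Y) \<le> nonneg_rank Y"
proof -
  obtain W H where WH: "W \<in> carrier_mat p (nonneg_rank Y)" "H \<in> carrier_mat (nonneg_rank Y) n"
    "nonneg_mat W" "nonneg_mat H" "Y = W * H"
    using assms(2) by (metis nonneg_rank_factorization[OF assms(4)] carrier_matD)
  have "A * Y = (A * W) * H" using WH assms(1) by (simp add: assoc_mult_mat)
  with WH assms show ?thesis
    by (intro nonneg_rank_le[of "A * W" _ _ H] nonneg_mat_mult) auto
qed

lemma nonneg_rank_transpose_le:
  assumes "nonneg_mat X"
  shows "nonneg_rank (transpose_mat X) \<le> nonneg_rank X"
proof -
  obtain W H where WH: "W \<in> carrier_mat (dim_row X) (nonneg_rank X)"
    "H \<in> carrier_mat (nonneg_rank X) (dim_col X)" "nonneg_mat W" "nonneg_mat H" "X = W * H"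
    using nonneg_rank_factorization[OF assms] .
  have T: "transpose_mat X = transpose_mat H * transpose_mat W"
    using transpose_mult[OF WH(1,2)] WH(5) by simp
  have "transpose_mat H \<in> carrier_mat (dim_row (transpose_mat X)) (nonneg_rank X)"
    "transpose_mat W \<in> carrier_mat (nonneg_rank X) (dim_col (transpose_mat X))"
    using WH(1,2) by auto
  moreover have "nonneg_mat (transpose_mat H)" "nonneg_mat (transpose_mat W)"
    using WH(3,4) by simp_all
  ultimately show ?thesis using T by (rule nonneg_rank_le)
qed

lemma nonneg_rank_transpose:
  assumes "nonneg_mat X"
  shows "nonneg_rank (transpose_mat X) = nonneg_rank X"
proof (rule antisym)
  show "nonneg_rank X \<le> nonneg_rank (transpose_mat X)"
    using nonneg_rank_transpose_le[of "transpose_mat X"] assms by simp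
qed (rule nonneg_rank_transpose_le[OF assms])

section \<open>An affine Farkas lemma for polytopes\<close>

lemma bounded_ray_eq_0:
  fixes x d :: "'a::real_normed_vector"
  assumes "bounded P" "\<And>s. s \<ge> 0 \<Longrightarrow> x + s *\<^sub>R d \<in> P"
  shows "d = 0"
proof (rule ccontr)
  assume "d \<noteq> 0"
  then have nd: "norm d > 0" by simp
  obtain B where B: "\<And>y. y \<in> P \<Longrightarrow> norm y \<le> B" using assms(1) bounded_iff by blast
  have "norm x \<le> B" using B assms(2)[of 0] by simp
  define s where "s = (B + norm x + 1) / norm d"
  have B0: "0 \<le> B + norm x + 1" using \<open>norm x \<le> B\<close> norm_ge_zero[of x] by linarith
  then have s0: "s \<ge> 0" unfolding s_def by simp
  have "norm (s *\<^sub>R d) \<le> norm (x + s *\<^sub>R d) + norm x"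
    by (metis add_diff_cancel_left' norm_triangle_ineq4 add.commute)
  moreover have "norm (s *\<^sub>R d) = B + norm x + 1" using nd B0 by (simp add: s_def)
  moreover have "norm (x + s *\<^sub>R d) \<le> B" using B assms(2) s0 by blast
  ultimately show False by linarith
qed

lemma bounded_polyhedron_recession_eq_0:
  fixes a :: "nat \<Rightarrow> 'a::real_inner"
  assumes P: "P = {x. \<forall>i<M. a i \<bullet> x \<le> b i}" and "bounded P" "x \<in> P"
    and d: "\<And>i. i < M \<Longrightarrow> a i \<bullet> d \<le> 0"
  shows "d = 0"
proof (rule bounded_ray_eq_0[OF \<open>bounded P\<close>])
  fix s :: real assume "s \<ge> 0"
  show "x + s *\<^sub>R d \<in> P"
    unfolding P
  proof (intro CollectI allI impI)
    fix i assume "i < M"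
    then have "a i \<bullet> x \<le> b i" "s * (a i \<bullet> d) \<le> 0"
      using \<open>x \<in> P\<close> d \<open>s \<ge> 0\<close> by (auto simp: P mult_nonneg_nonpos)
    then show "a i \<bullet> (x + s *\<^sub>R d) \<le> b i" by (simp add: inner_add_right)
  qed
qed

text \<open>The two distinct points are needed only for \<open>t < 0\<close>: then \<open>z / t\<close> lies on or beyond every
  facet, which would squeeze \<open>P\<close> to a single point.\<close>
lemma bounded_polyhedron_dual_nonneg:
  fixes a :: "nat \<Rightarrow> 'a::real_inner" and g z :: 'a
  assumes P: "P = {x. \<forall>i<M. a i \<bullet> x \<le> b i}" and bnd: "bounded P"
    and x12: "x1 \<in> P" "x2 \<in> P" "x1 \<noteq> x2"
    and nn: "\<And>x. x \<in> P \<Longrightarrow> 0 \<le> g \<bullet> x + h"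
    and zt: "\<And>i. i < M \<Longrightarrow> a i \<bullet> z \<le> t * b i"
  shows "0 \<le> g \<bullet> z + t * h"
proof -
  consider "t > 0" | "t = 0" | "t < 0" by linarith
  then show ?thesis
  proof cases
    case 1
    have "(1 / t) *\<^sub>R z \<in> P"
      unfolding P using zt 1 by (auto simp: field_simps)
    then have "0 \<le> t * (g \<bullet> ((1 / t) *\<^sub>R z) + h)" using nn 1 by (simp del: inner_scaleR_right)
    then show ?thesis using 1 by (simp add: algebra_simps)
  next
    case 2
    then have "z = 0"
      using bounded_polyhedron_recession_eq_0[OF P bnd x12(1)] zt by simp
    then show ?thesis using 2 by simp
  next
    case 3
    define q where "q = (1 / t) *\<^sub>R z"
    have "b i \<le> a i \<bullet> q" if "i < M" for i
      using zt[OF that] 3 by (simp add: q_def field_simps)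
    then have "x - q = 0" if "x \<in> P" for x
      using that by (intro bounded_polyhedron_recession_eq_0[OF P bnd that])
        (fastforce simp: P inner_diff_right)
    then show ?thesis using x12 by (metis eq_iff_diff_eq_0)
  qed
qed

lemma convex_cone_hull_finite_nonneg_sum:
  fixes \<phi> :: "nat \<Rightarrow> 'a::real_vector"
  assumes "z \<in> convex_cone hull (\<phi> ` {..<M})"
  obtains l where "\<And>i. i < M \<Longrightarrow> 0 \<le> l i" "z = (\<Sum>i<M. l i *\<^sub>R \<phi> i)"
proof -
  define K where "K = {(\<Sum>i<M. l i *\<^sub>R \<phi> i) | l. \<forall>i<M. 0 \<le> l i}"
  have "convex_cone K"
    unfolding convex_cone_iff
  proof (intro conjI ballI allI impI)
    show "0 \<in> K" unfolding K_def by (intro CollectI exI[of _ "\<lambda>_. 0"]) simp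
  next
    fix x y assume "x \<in> K" "y \<in> K"
    then obtain l l' where "x = (\<Sum>i<M. l i *\<^sub>R \<phi> i)" "\<forall>i<M. 0 \<le> l i"
      "y = (\<Sum>i<M. l' i *\<^sub>R \<phi> i)" "\<forall>i<M. 0 \<le> l' i" unfolding K_def by blast
    then show "x + y \<in> K" unfolding K_def
      by (intro CollectI exI[of _ "\<lambda>i. l i + l' i"]) (simp add: scaleR_add_left sum.distrib)
  next
    fix x and c :: real assume "x \<in> K" "0 \<le> c"
    then obtain l where "x = (\<Sum>i<M. l i *\<^sub>R \<phi> i)" "\<forall>i<M. 0 \<le> l i" unfolding K_def by blast
    with \<open>0 \<le> c\<close> show "c *\<^sub>R x \<in> K" unfolding K_def
      by (intro CollectI exI[of _ "\<lambda>i. c * l i"]) (simp add: scaleR_sum_right)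
  qed
  moreover have "\<phi> ` {..<M} \<subseteq> K"
  proof
    fix w assume "w \<in> \<phi> ` {..<M}"
    then obtain j where j: "j < M" "w = \<phi> j" by auto
    then have "w = (\<Sum>i<M. (if i = j then 1 else 0) *\<^sub>R \<phi> i)"
      by (simp add: if_distrib[of "\<lambda>c. c *\<^sub>R _"] cong: if_cong)
    then show "w \<in> K" unfolding K_def by (intro CollectI exI[of _ "\<lambda>i. if i = j then 1 else 0"]) auto
  qed
  ultimately have "convex_cone hull (\<phi> ` {..<M}) \<subseteq> K"
    by (intro hull_minimal)
  with assms that show ?thesis unfolding K_def by blast
qed

lemma conic_separation_nonneg:
  fixes y :: "'a::real_inner"
  assumes "conic C" "\<And>w. w \<in> C \<Longrightarrow> c < y \<bullet> w" "w \<in> C"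
  shows "0 \<le> y \<bullet> w"
proof (rule ccontr)
  assume neg: "\<not> 0 \<le> y \<bullet> w"
  define s where "s = (\<bar>c\<bar> + 1) / - (y \<bullet> w)"
  have "0 \<le> s" using neg by (simp add: s_def divide_nonneg_neg)
  then have "s *\<^sub>R w \<in> C" using assms(1,3) by (intro conicD)
  then have "c < y \<bullet> (s *\<^sub>R w)" by (rule assms(2))
  moreover have "y \<bullet> (s *\<^sub>R w) = - (\<bar>c\<bar> + 1)" using neg by (simp add: s_def)
  ultimately show False by linarith
qed

theorem affine_farkas_polytope:
  fixes a :: "nat \<Rightarrow> 'a::euclidean_space" and g :: 'a
  assumes P: "P = {x. \<forall>i<M. a i \<bullet> x \<le> b i}" and bnd: "bounded P"
    and x12: "x1 \<in> P" "x2 \<in> P" "x1 \<noteq> x2"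
    and nn: "\<And>x. x \<in> P \<Longrightarrow> 0 \<le> g \<bullet> x + h"
  shows "\<exists>l. (\<forall>i<M. 0 \<le> l i) \<and> (\<forall>x. g \<bullet> x + h = (\<Sum>i<M. l i * (b i - a i \<bullet> x)))"
proof -
  define \<phi> where "\<phi> i = (- a i, b i)" for i
  define C where "C = convex_cone hull (\<phi> ` {..<M})"
  have "(g, h) \<in> C"
  proof (rule ccontr)
    assume "(g, h) \<notin> C"
    moreover have "closed C" "convex C"
      unfolding C_def by (simp_all add: closed_convex_cone_hull convex_convex_cone_hull)
    ultimately obtain y c where yc: "y \<bullet> (g, h) < c" "\<And>w. w \<in> C \<Longrightarrow> c < y \<bullet> w"
      using separating_hyperplane_closed_point by metis
    obtain z t where y: "y = (z, t)" by (cases y)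
    have "0 \<le> y \<bullet> \<phi> i" if "i < M" for i
    proof (rule conic_separation_nonneg[OF _ yc(2)])
      show "conic C" unfolding C_def by (rule conic_convex_cone_hull)
      show "\<phi> i \<in> C" unfolding C_def using that by (intro hull_inc) simp
    qed
    then have "a i \<bullet> z \<le> t * b i" if "i < M" for i
      using that by (simp add: y \<phi>_def inner_commute)
    then have "0 \<le> g \<bullet> z + t * h"
      using bounded_polyhedron_dual_nonneg[OF P bnd x12 nn] by blast
    moreover have "c < 0" using yc(2)[of 0] by (simp add: C_def convex_cone_hull_contains_0)
    moreover have "y \<bullet> (g, h) = g \<bullet> z + t * h" by (simp add: y inner_commute mult.commute)
    ultimately show False using yc(1) by linarith
  qed
  then obtain l where l: "\<And>i. i < M \<Longrightarrow> 0 \<le> l i" "(g, h) = (\<Sum>i<M. l i *\<^sub>R \<phi> i)"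
    using convex_cone_hull_finite_nonneg_sum unfolding C_def by blast
  have "g = (\<Sum>i<M. l i *\<^sub>R (- a i))" "h = (\<Sum>i<M. l i * b i)"
    using arg_cong[OF l(2), of fst] arg_cong[OF l(2), of snd] by (simp_all add: fst_sum snd_sum \<phi>_def)
  then have "g \<bullet> x + h = (\<Sum>i<M. l i * (b i - a i \<bullet> x))" for x
    by (simp add: inner_sum_left right_diff_distrib sum_subtractf sum_negf)
  with l(1) show ?thesis by blast
qed

section \<open>Facet descriptions of polygons\<close>

lemma halfspaces_crossing_point:
  fixes a :: "'i \<Rightarrow> 'a::real_inner"
  assumes x: "\<And>i. i \<in> F \<Longrightarrow> a i \<bullet> x < b i"
    and z: "\<And>i. i \<in> F \<Longrightarrow> i \<noteq> h \<Longrightarrow> a i \<bullet> z \<le> b i" "b h < a h \<bullet> z"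
    and "h \<in> F"
  obtains w where "w \<in> open_segment x z" "a h \<bullet> w = b h"
    "\<And>i. i \<in> F \<Longrightarrow> i \<noteq> h \<Longrightarrow> a i \<bullet> w < b i"
proof -
  have xh: "a h \<bullet> x < b h" using x \<open>h \<in> F\<close> .
  define l where "l = (b h - a h \<bullet> x) / (a h \<bullet> z - a h \<bullet> x)"
  define w where "w = (1 - l) *\<^sub>R x + l *\<^sub>R z"
  have l: "0 < l" "l < 1" using xh z(2) by (auto simp: l_def field_split_simps)
  have "x \<noteq> z" using xh z(2) by auto
  with l have "w \<in> open_segment x z" by (auto simp: in_segment w_def)
  moreover have "a h \<bullet> w = b h"
    using xh z(2) unfolding w_def l_def by (simp add: algebra_simps) (simp add: field_simps)
  moreover have "a i \<bullet> w < b i" if "i \<in> F" "i \<noteq> h" for i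
  proof -
    have "(1 - l) * (a i \<bullet> x) < (1 - l) * b i" using l x[OF that(1)] by simp
    moreover have "l * (a i \<bullet> z) \<le> l * b i" using l z(1)[OF that] by simp
    ultimately show ?thesis by (simp add: w_def algebra_simps)
  qed
  ultimately show ?thesis using that by blast
qed

lemma polyhedron_explicit_strict_point:
  fixes S :: "'a::euclidean_space set" and a :: "'a set \<Rightarrow> 'a"
  assumes "finite F"
    and seq: "S = affine hull S \<inter> \<Inter>F"
    and faceq: "\<And>h. h \<in> F \<Longrightarrow> a h \<noteq> 0 \<and> h = {x. a h \<bullet> x \<le> b h}"
    and psub: "\<And>F'. F' \<subset> F \<Longrightarrow> S \<subset> affine hull S \<inter> \<Inter>F'"
    and "S \<noteq> {}"
  obtains x where "x \<in> S" "\<forall>i\<in>F. a i \<bullet> x < b i"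
proof -
  have "polyhedron S"
    unfolding polyhedron_Int_affine
  proof (intro exI[of _ F] conjI ballI)
    show "\<exists>c d. c \<noteq> 0 \<and> i = {x. c \<bullet> x \<le> d}" if "i \<in> F" for i
      using faceq[OF that] by blast
  qed (fact \<open>finite F\<close> seq)+
  then obtain x where "x \<in> rel_interior S"
    using \<open>S \<noteq> {}\<close> polyhedron_imp_convex rel_interior_eq_empty by blast
  moreover have "rel_interior S = {x \<in> S. \<forall>h\<in>F. a h \<bullet> x < b h}"
    by (rule rel_interior_polyhedron_explicit[OF \<open>finite F\<close> seq faceq psub])
  ultimately show ?thesis using that by blast
qed

lemma polyhedron_explicit_facet_witness:
  fixes S :: "'a::euclidean_space set" and a :: "'a set \<Rightarrow> 'a"
  assumes "finite F"
    and seq: "S = affine hull S \<inter> \<Inter>F"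
    and faceq: "\<And>h. h \<in> F \<Longrightarrow> a h \<noteq> 0 \<and> h = {x. a h \<bullet> x \<le> b h}"
    and psub: "\<And>F'. F' \<subset> F \<Longrightarrow> S \<subset> affine hull S \<inter> \<Inter>F'"
    and "h \<in> F"
  obtains w where "w \<in> S" "a h \<bullet> w = b h" "\<And>i. i \<in> F \<Longrightarrow> i \<noteq> h \<Longrightarrow> a i \<bullet> w < b i"
proof -
  have "F - {h} \<subset> F" using \<open>h \<in> F\<close> by blast
  then have "S \<subset> affine hull S \<inter> \<Inter>(F - {h})" by (rule psub)
  then obtain z where zaff: "z \<in> affine hull S" and zint: "z \<in> \<Inter>(F - {h})" and "z \<notin> S"
    by blast
  have "z \<notin> h"
  proof
    assume "z \<in> h"
    then have "z \<in> \<Inter>F" using zint by blast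
    with zaff seq \<open>z \<notin> S\<close> show False by blast
  qed
  then have zh: "b h < a h \<bullet> z" using faceq[OF \<open>h \<in> F\<close>] by force
  have z: "\<And>i. i \<in> F \<Longrightarrow> i \<noteq> h \<Longrightarrow> a i \<bullet> z \<le> b i" using zint faceq by blast
  have "S \<noteq> {}" using \<open>S \<subset> _\<close> by auto
  then obtain x where "x \<in> S" and "\<forall>i\<in>F. a i \<bullet> x < b i"
    using polyhedron_explicit_strict_point[OF \<open>finite F\<close> seq faceq psub] by blast
  then have x: "\<And>i. i \<in> F \<Longrightarrow> a i \<bullet> x < b i" by blast
  obtain w where w: "w \<in> open_segment x z" "a h \<bullet> w = b h"
    "\<And>i. i \<in> F \<Longrightarrow> i \<noteq> h \<Longrightarrow> a i \<bullet> w < b i"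
    using halfspaces_crossing_point[where F=F and a=a and b=b and x=x and z=z and h=h]
      x z zh \<open>h \<in> F\<close> by blast
  have "open_segment x z \<subseteq> affine hull S"
    using \<open>x \<in> S\<close> zaff hull_inc[of x S affine] convex_contains_open_segment[of "affine hull S"]
    by simp
  with w(1) have "w \<in> affine hull S" by blast
  moreover have "w \<in> \<Inter>F"
  proof
    fix i assume "i \<in> F"
    have "a i \<bullet> w \<le> b i"
      using w(2) w(3)[OF \<open>i \<in> F\<close>] by (cases "i = h") (simp_all add: less_imp_le)
    then show "w \<in> i" using faceq[OF \<open>i \<in> F\<close>] by blast
  qed
  ultimately have "w \<in> S" using seq by blast
  with w(2,3) that show ?thesis by blast
qed

lemma facet_description_exists:
  fixes P :: "(real^2) set"
  assumes "polytope P" "affine hull P = UNIV"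
  obtains m a b where "facet_description P m a b"
proof -
  obtain F where F: "finite F" and seq: "P = affine hull P \<inter> \<Inter>F"
    and faces: "\<And>h. h \<in> F \<Longrightarrow> \<exists>a b. a \<noteq> 0 \<and> h = {x. a \<bullet> x \<le> b}"
    and min: "\<And>F'. F' \<subset> F \<Longrightarrow> P \<subset> affine hull P \<inter> \<Inter>F'"
    using polytope_imp_polyhedron[OF assms(1)] by (simp add: polyhedron_Int_affine_minimal) meson
  then obtain a b where ab: "\<And>h. h \<in> F \<Longrightarrow> a h \<noteq> 0 \<and> h = {x. a h \<bullet> x \<le> b h}"
    by metis
  obtain e where e: "bij_betw e {..<card F} F"
    using ex_bij_betw_nat_finite[OF F] by (auto simp: atLeast0LessThan)
  then have eF: "e i \<in> F" if "i < card F" for i using that by (auto simp: bij_betw_def)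
  have "facet_description P (card F) (\<lambda>i. a (e i)) (\<lambda>i. b (e i))"
    unfolding facet_description_def
  proof (intro conjI allI impI)
    have "P = \<Inter>(e ` {..<card F})" using seq assms(2) e by (simp add: bij_betw_def)
    also have "\<dots> = (\<Inter>i<card F. {x. a (e i) \<bullet> x \<le> b (e i)})"
      using ab eF by (intro INF_cong) auto
    finally show "P = {x. \<forall>i<card F. a (e i) \<bullet> x \<le> b (e i)}" by auto
  next
    fix i assume "i < card F"
    then show "{x \<in> P. a (e i) \<bullet> x = b (e i)} facet_of P"
      using facet_of_polyhedron_explicit[OF F seq ab min] eF by (auto simp: Int_def)
  next
    show "inj_on (\<lambda>i. {x \<in> P. a (e i) \<bullet> x = b (e i)}) {..<card F}"
    proof (rule inj_onI, rule ccontr)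
      fix i j assume i: "i \<in> {..<card F}" and j: "j \<in> {..<card F}" and "i \<noteq> j"
        and eq: "{x \<in> P. a (e i) \<bullet> x = b (e i)} = {x \<in> P. a (e j) \<bullet> x = b (e j)}"
      obtain w where w: "w \<in> P" "a (e i) \<bullet> w = b (e i)"
        "\<And>k. k \<in> F \<Longrightarrow> k \<noteq> e i \<Longrightarrow> a k \<bullet> w < b k"
        using polyhedron_explicit_facet_witness[OF F seq ab min eF] i by blast
      have "e i \<noteq> e j" using e i j \<open>i \<noteq> j\<close> by (auto simp: bij_betw_def inj_on_def)
      then have "a (e j) \<bullet> w < b (e j)" using w(3) eF j by simp
      moreover have "a (e j) \<bullet> w = b (e j)" using eq w(1,2) by blast
      ultimately show False by simp
    qed
  qed
  with that show ?thesis by blast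
qed

lemma three_extreme_points_affine_hull_UNIV:
  fixes x y z :: "real^2"
  assumes "x extreme_point_of C" "y extreme_point_of C" "z extreme_point_of C"
    and "x \<noteq> y" "x \<noteq> z" "y \<noteq> z"
  shows "affine hull C = UNIV"
proof -
  have "u \<notin> open_segment v w" if "u \<in> {x, y, z}" "v \<in> {x, y, z}" "w \<in> {x, y, z}" for u v w
    using that assms(1-3) unfolding extreme_point_of_def by blast
  then have "\<not> between (y, z) x" "\<not> between (z, x) y" "\<not> between (x, y) z"
    using assms(4-6) by (auto simp: between_mem_segment open_segment_def)
  then have "\<not> collinear {x, y, z}" by (simp add: collinear_between_cases)
  then have "aff_dim {x, y, z} = 2"
    using assms(4-6) aff_dim_affine_independent[of "{x, y, z}"]
    by (simp add: collinear_3_eq_affine_dependent)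
  moreover have "{x, y, z} \<subseteq> C" using assms(1-3) by (auto simp: extreme_point_of_def)
  ultimately have "2 \<le> aff_dim C" by (metis aff_dim_subset)
  then have "aff_dim C = int DIM(real^2)" using aff_dim_le_DIM[of C] by simp
  then show ?thesis using aff_dim_eq_full[of C] by simp
qed

section \<open>Nonnegative factorizations through polygons\<close>

text \<open>The hypothesis of the theorem, with \<open>\<lfloor>(n+6)/2\<rfloor>\<close> abstracted to a bound \<open>\<beta> n\<close>.\<close>
definition polygon_slack_rank_bound :: "(nat \<Rightarrow> int) \<Rightarrow> bool" where
  "polygon_slack_rank_bound \<beta> \<longleftrightarrow> (\<forall>n::nat. n \<ge> 3 \<longrightarrow> (\<forall>v. convex_polygon_vertices n v \<longrightarrow>
      (\<forall>m a b. facet_description (convex hull (v ` {..<n})) m a b \<longrightarrow>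
         int (nonneg_rank (slack_matrix m n a b v)) \<le> \<beta> n)))"

lemma convex_hull_vertex_enumeration:
  fixes Q :: "(real^2) set"
  assumes "finite Q"
  obtains k v where "convex_polygon_vertices k v" "convex hull (v ` {..<k}) = convex hull Q"
    "k \<le> card Q"
proof -
  define E where "E = {x. x extreme_point_of convex hull Q}"
  have "E \<subseteq> Q" unfolding E_def using extreme_points_of_convex_hull by blast
  then have "finite E" "card E \<le> card Q" using assms by (auto intro: finite_subset card_mono)
  then obtain v where v: "bij_betw v {..<card E} E"
    using ex_bij_betw_nat_finite[of E] by (auto simp: atLeast0LessThan)
  then have "v ` {..<card E} = E" by (simp add: bij_betw_def)
  moreover have "convex hull E = convex hull Q"
    unfolding E_def by (rule Krein_Milman_polytope[OF assms, symmetric])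
  ultimately have "convex_polygon_vertices (card E) v"
    using v by (auto simp: convex_polygon_vertices_def bij_betw_def E_def)
  with \<open>v ` _ = E\<close> \<open>convex hull E = _\<close> \<open>card E \<le> card Q\<close> that show ?thesis by auto
qed

lemma affine_representation_factor_through_vertices:
  fixes g p v :: "nat \<Rightarrow> real^2"
  assumes "X \<in> carrier_mat m n" "inj_on v {..<k}"
    and rep: "\<And>r j. r < m \<Longrightarrow> j < n \<Longrightarrow> X $$ (r, j) = \<sigma> j * (g r \<bullet> p j + h r)"
    and \<sigma>: "\<And>j. j < n \<Longrightarrow> 0 \<le> \<sigma> j"
    and hull: "\<And>j. j < n \<Longrightarrow> 0 < \<sigma> j \<Longrightarrow> p j \<in> convex hull (v ` {..<k})"
  obtains C where "C \<in> carrier_mat k n" "nonneg_mat C"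
    "X = mat m k (\<lambda>(r, t). g r \<bullet> v t + h r) * C"
proof -
  have "\<exists>\<mu>. (\<forall>t<k. 0 \<le> \<mu> t) \<and> sum \<mu> {..<k} = 1 \<and> (\<Sum>t<k. \<mu> t *\<^sub>R v t) = p j"
    if j: "j < n" "0 < \<sigma> j" for j
  proof -
    obtain u where u: "\<forall>x\<in>v ` {..<k}. 0 \<le> u x" "sum u (v ` {..<k}) = 1"
      "(\<Sum>x\<in>v ` {..<k}. u x *\<^sub>R x) = p j"
      using hull[OF j] by (auto simp: convex_hull_finite)
    then show ?thesis
      using sum.reindex[OF \<open>inj_on v _\<close>, of u] sum.reindex[OF \<open>inj_on v _\<close>, of "\<lambda>x. u x *\<^sub>R x"]
      by (intro exI[of _ "u \<circ> v"]) auto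
  qed
  then obtain \<mu> where \<mu>: "\<And>j. j < n \<Longrightarrow> 0 < \<sigma> j \<Longrightarrow>
      (\<forall>t<k. 0 \<le> \<mu> j t) \<and> sum (\<mu> j) {..<k} = 1 \<and> (\<Sum>t<k. \<mu> j t *\<^sub>R v t) = p j"
    by metis
  define N where "N = mat m k (\<lambda>(r, t). g r \<bullet> v t + h r)"
  define C where "C = mat k n (\<lambda>(t, j). if 0 < \<sigma> j then \<sigma> j * \<mu> j t else 0)"
  have C: "C \<in> carrier_mat k n" "N \<in> carrier_mat m k" by (simp_all add: C_def N_def)
  have "X $$ (r, j) = (N * C) $$ (r, j)" if "r < m" "j < n" for r j
  proof (cases "0 < \<sigma> j")
    case True
    have "(N * C) $$ (r, j) = \<sigma> j * (\<Sum>t<k. \<mu> j t * (g r \<bullet> v t) + \<mu> j t * h r)"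
      unfolding index_mult_mat_sum[OF C(2,1) that] using that True
      by (simp add: N_def C_def sum_distrib_left algebra_simps)
    also have "\<dots> = \<sigma> j * (g r \<bullet> p j + h r)"
    proof -
      have "sum (\<mu> j) {..<k} = 1" "p j = (\<Sum>t<k. \<mu> j t *\<^sub>R v t)"
        using \<mu>[OF \<open>j < n\<close> True] by auto
      then show ?thesis by (simp add: sum.distrib inner_sum_right flip: sum_distrib_right)
    qed
    finally show ?thesis using rep that by simp
  next
    case False
    then show ?thesis
      unfolding index_mult_mat_sum[OF C(2,1) that] using that rep \<sigma>[of j] by (simp add: C_def)
  qed
  then have "X = N * C" using assms(1) C by (intro eq_matI) auto
  moreover have "nonneg_mat C" using \<mu> \<sigma> by (auto simp: nonneg_mat_def C_def)
  ultimately show ?thesis using that C unfolding N_def by blast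
qed

lemma nonneg_rank_values_le_slack:
  fixes a g v :: "nat \<Rightarrow> real^2"
  assumes P: "P = {x. \<forall>i<M. a i \<bullet> x \<le> b i}" and "bounded P"
    and "x1 \<in> P" "x2 \<in> P" "x1 \<noteq> x2" and v: "\<And>t. t < k \<Longrightarrow> v t \<in> P"
    and nn: "\<And>r x. r < m \<Longrightarrow> x \<in> P \<Longrightarrow> 0 \<le> g r \<bullet> x + h r"
  shows "nonneg_rank (mat m k (\<lambda>(r, t). g r \<bullet> v t + h r)) \<le> nonneg_rank (slack_matrix M k a b v)"
proof -
  have "\<exists>l. (\<forall>i<M. 0 \<le> l i) \<and> (\<forall>x. g r \<bullet> x + h r = (\<Sum>i<M. l i * (b i - a i \<bullet> x)))"
    if "r < m" for r
    using nn[OF that] by (rule affine_farkas_polytope[OF assms(1-5)])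
  then obtain L where L: "\<And>r. r < m \<Longrightarrow> (\<forall>i<M. 0 \<le> L r i) \<and>
      (\<forall>x. g r \<bullet> x + h r = (\<Sum>i<M. L r i * (b i - a i \<bullet> x)))"
    by metis
  define S where "S = slack_matrix M k a b v"
  define Lm where "Lm = mat m M (\<lambda>(r, i). L r i)"
  have c: "Lm \<in> carrier_mat m M" "S \<in> carrier_mat M k" by (simp_all add: Lm_def S_def slack_matrix_def)
  have "mat m k (\<lambda>(r, t). g r \<bullet> v t + h r) = Lm * S"
  proof (rule eq_matI)
    fix r t assume "r < dim_row (Lm * S)" "t < dim_col (Lm * S)"
    then have rt: "r < m" "t < k" using c by auto
    show "mat m k (\<lambda>(r, t). g r \<bullet> v t + h r) $$ (r, t) = (Lm * S) $$ (r, t)"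
      unfolding index_mult_mat_sum[OF c rt] using L[OF rt(1)] rt
      by (simp add: Lm_def S_def slack_matrix_def)
  qed (use c in auto)
  moreover have "nonneg_mat Lm" using L by (simp add: nonneg_mat_def Lm_def)
  moreover have "nonneg_mat S" using v P by (auto simp: nonneg_mat_def S_def slack_matrix_def)
  ultimately show ?thesis using nonneg_rank_mult_left_le[OF c] unfolding S_def by simp
qed

lemma polygon_values_nonneg_rank_le:
  fixes g :: "nat \<Rightarrow> real^2"
  assumes \<beta>: "polygon_slack_rank_bound \<beta>"
    and v: "convex_polygon_vertices k v" "3 \<le> k"
    and nn: "\<And>r x. r < m \<Longrightarrow> x \<in> convex hull (v ` {..<k}) \<Longrightarrow> 0 \<le> g r \<bullet> x + h r"
  shows "int (nonneg_rank (mat m k (\<lambda>(r, t). g r \<bullet> v t + h r))) \<le> \<beta> k"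
proof -
  define P where "P = convex hull (v ` {..<k})"
  have ext: "v t extreme_point_of P" "v t \<in> P" if "t < k" for t
    using v that by (auto simp: convex_polygon_vertices_def P_def extreme_point_of_def)
  have "v 0 \<noteq> v 1" "v 0 \<noteq> v 2" "v 1 \<noteq> v 2"
    using v unfolding convex_polygon_vertices_def by (auto dest: inj_onD)
  then have "affine hull P = UNIV"
    using ext(1)[of 0] ext(1)[of 1] ext(1)[of 2] v(2)
    by (intro three_extreme_points_affine_hull_UNIV[of "v 0" P "v 1" "v 2"]) auto
  moreover have "polytope P" unfolding P_def polytope_def by blast
  ultimately obtain M a b where fd: "facet_description P M a b"
    using facet_description_exists by blast
  have "nonneg_rank (mat m k (\<lambda>(r, t). g r \<bullet> v t + h r)) \<le> nonneg_rank (slack_matrix M k a b v)"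
  proof (rule nonneg_rank_values_le_slack)
    show "P = {x. \<forall>i<M. a i \<bullet> x \<le> b i}" using fd by (simp add: facet_description_def)
    show "bounded P" unfolding P_def by (simp add: finite_imp_bounded_convex_hull)
    show "v 0 \<in> P" "v 1 \<in> P" using ext(2) v(2) by auto
  qed (use \<open>v 0 \<noteq> v 1\<close> ext(2) nn in \<open>auto simp: P_def\<close>)
  moreover have "int (nonneg_rank (slack_matrix M k a b v)) \<le> \<beta> k"
    using \<beta> v fd unfolding polygon_slack_rank_bound_def P_def by blast
  ultimately show ?thesis by linarith
qed

lemma affine_representation_nonneg_on_hull:
  fixes g p :: "nat \<Rightarrow> real^2"
  assumes X: "X \<in> carrier_mat m n" "nonneg_mat X"
    and rep: "\<And>r j. r < m \<Longrightarrow> j < n \<Longrightarrow> X $$ (r, j) = \<sigma> j * (g r \<bullet> p j + h r)"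
    and "r < m" "x \<in> convex hull (p ` {j. j < n \<and> 0 < \<sigma> j})"
  shows "0 \<le> g r \<bullet> x + h r"
proof -
  have "0 \<le> g r \<bullet> p j + h r" if "j < n" "0 < \<sigma> j" for j
  proof -
    have "0 \<le> X $$ (r, j)" using X \<open>r < m\<close> \<open>j < n\<close> by (simp add: nonneg_mat_def)
    then show ?thesis using rep[OF \<open>r < m\<close> \<open>j < n\<close>] \<open>0 < \<sigma> j\<close> by (simp add: zero_le_mult_iff)
  qed
  then have "p ` {j. j < n \<and> 0 < \<sigma> j} \<subseteq> {x. - h r \<le> g r \<bullet> x}" by force
  then have "convex hull (p ` {j. j < n \<and> 0 < \<sigma> j}) \<subseteq> {x. - h r \<le> g r \<bullet> x}"
    by (intro hull_minimal convex_halfspace_ge)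
  with assms(5) show ?thesis by auto
qed

lemma nonneg_rank_affine_representation_le:
  fixes g p :: "nat \<Rightarrow> real^2"
  assumes \<beta>: "polygon_slack_rank_bound \<beta>" "mono \<beta>" "\<And>k. k \<le> 2 \<Longrightarrow> int k \<le> \<beta> k"
    and X: "X \<in> carrier_mat m n" "nonneg_mat X"
    and rep: "\<And>r j. r < m \<Longrightarrow> j < n \<Longrightarrow> X $$ (r, j) = \<sigma> j * (g r \<bullet> p j + h r)"
    and \<sigma>: "\<And>j. j < n \<Longrightarrow> 0 \<le> \<sigma> j"
  shows "int (nonneg_rank X) \<le> \<beta> n"
proof -
  define J where "J = {j. j < n \<and> 0 < \<sigma> j}"
  have "J \<subseteq> {..<n}" unfolding J_def by blast
  then have "finite J" "card J \<le> n" using finite_subset card_mono[of "{..<n}" J] by auto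
  obtain k v where v: "convex_polygon_vertices k v"
    and hull: "convex hull (v ` {..<k}) = convex hull (p ` J)" and "k \<le> card (p ` J)"
    using \<open>finite J\<close> by (blast intro: convex_hull_vertex_enumeration[of "p ` J"])
  have "k \<le> n" using \<open>k \<le> card (p ` J)\<close> card_image_le[OF \<open>finite J\<close>, of p] \<open>card J \<le> n\<close>
    by linarith
  have nn: "0 \<le> g r \<bullet> x + h r" if "r < m" "x \<in> convex hull (v ` {..<k})" for r x
    using affine_representation_nonneg_on_hull[OF X rep] that hull by (simp add: J_def)
  have inj: "inj_on v {..<k}" using v by (simp add: convex_polygon_vertices_def)
  have in_hull: "p j \<in> convex hull (v ` {..<k})" if "j < n" "0 < \<sigma> j" for j
    unfolding hull using that by (intro hull_inc) (auto simp: J_def)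
  obtain C where C: "C \<in> carrier_mat k n" "nonneg_mat C"
    and XNC: "X = mat m k (\<lambda>(r, t). g r \<bullet> v t + h r) * C"
    using affine_representation_factor_through_vertices[OF X(1) inj rep \<sigma> in_hull] by blast
  have N: "mat m k (\<lambda>(r, t). g r \<bullet> v t + h r) \<in> carrier_mat m k"
    "nonneg_mat (mat m k (\<lambda>(r, t). g r \<bullet> v t + h r))"
    using nn v by (auto simp: nonneg_mat_def convex_polygon_vertices_def hull_inc)
  show ?thesis
  proof (cases "k \<le> 2")
    case True
    have "nonneg_rank X \<le> k" using N C X(1) XNC by (intro nonneg_rank_le) auto
    then show ?thesis using \<beta>(3)[OF True] monoD[OF \<beta>(2) \<open>k \<le> n\<close>] by linarith
  next
    case False
    have "nonneg_rank X \<le> nonneg_rank (mat m k (\<lambda>(r, t). g r \<bullet> v t + h r))"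
      unfolding XNC using N C by (intro nonneg_rank_mult_right_le)
    also have "int \<dots> \<le> \<beta> k"
      using False by (intro polygon_values_nonneg_rank_le[OF \<beta>(1) v] nn) auto
    finally show ?thesis using monoD[OF \<beta>(2) \<open>k \<le> n\<close>] by linarith
  qed
qed

section \<open>Matrices of rank three\<close>

lemma rank_factorization:
  fixes X :: "'a::field mat"
  assumes X: "X \<in> carrier_mat m n"
  shows "\<exists>U V. \<forall>r<m. \<forall>j<n. X $$ (r, j) = (\<Sum>t<vec_space.rank m X. U r t * V t j)"
proof -
  interpret vec_space "TYPE('a)" m .
  have cols: "set (cols X) \<subseteq> carrier_vec m" using X cols_dim by blast
  obtain S where "finite S" and S: "maximal S (\<lambda>T. T \<subseteq> set (cols X) \<and> lin_indpt T)"
    using maximal_exists_superset[of "set (cols X)" "\<lambda>T. T \<subseteq> set (cols X) \<and> lin_indpt T" "{}"]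
    by (auto simp: lin_dep_def)
  have SX: "S \<subseteq> set (cols X)" and "lin_indpt S" using S by (auto simp: maximal_def)
  then have Sc: "S \<subseteq> carrier_vec m" using cols by blast
  have span: "c \<in> span S" if "c \<in> set (cols X)" for c
  proof (rule ccontr)
    assume "c \<notin> span S"
    then have "c \<notin> S" using in_own_span[OF Sc] by blast
    have "lin_indpt (insert c S)"
      using lin_dep_iff_in_span[OF Sc \<open>lin_indpt S\<close> _ \<open>c \<notin> S\<close>] \<open>c \<notin> span S\<close> that cols by auto
    with S that SX have "insert c S = S" unfolding maximal_def by blast
    with \<open>c \<notin> S\<close> show False by blast
  qed
  have "\<exists>a. col X j = lincomb a S" if "j < n" for j
  proof -
    have "col X j \<in> set (cols X)" using that X by (metis carrier_matD(2) cols_length cols_nth nth_mem)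
    then show ?thesis using span finite_span[OF \<open>finite S\<close> Sc] by blast
  qed
  then obtain A where A: "\<And>j. j < n \<Longrightarrow> col X j = lincomb (A j) S" by metis
  have "rank X = card S" using rank_card_indpt[OF X S] .
  then obtain e where e: "bij_betw e {..<rank X} S"
    using ex_bij_betw_nat_finite[OF \<open>finite S\<close>] by (auto simp: atLeast0LessThan)
  have entries: "X $$ (r, j) = (\<Sum>t<rank X. e t $ r * A j (e t))" if "r < m" "j < n" for r j
  proof -
    have "X $$ (r, j) = col X j $ r" using that X by simp
    also have "\<dots> = lincomb (A j) S $ r" using A[OF \<open>j < n\<close>] by simp
    also have "\<dots> = (\<Sum>x\<in>S. A j x * x $ r)" by (rule lincomb_index[OF \<open>r < m\<close> Sc])
    also have "\<dots> = (\<Sum>t<rank X. e t $ r * A j (e t))"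
      by (simp add: sum.reindex_bij_betw[OF e, symmetric] mult.commute)
    finally show ?thesis .
  qed
  then show ?thesis by (intro exI[of _ "\<lambda>r t. e t $ r"] exI[of _ "\<lambda>t j. A j (e t)"]) simp
qed

lemma sum_lessThan_3_rotate:
  fixes f :: "nat \<Rightarrow> 'a::comm_monoid_add"
  assumes "c < 3"
  shows "(\<Sum>t<3. f t) = f ((c + 1) mod 3) + f ((c + 2) mod 3) + f c"
proof -
  have sum3: "(\<Sum>t<3. f t) = f 0 + f 1 + f 2" by (simp add: eval_nat_numeral)
  consider "c = 0" | "c = 1" | "c = 2" using assms by linarith
  then show ?thesis by cases (simp_all add: sum3 ac_simps numeral_2_eq_2)
qed

text \<open>Dividing column \<open>j\<close> by its sum \<open>\<sigma>\<^sub>j = s\<^sub>A a\<^sub>j + s\<^sub>B b\<^sub>j + s\<^sub>C c\<^sub>j\<close> (where \<open>s\<^sub>A, s\<^sub>B, s\<^sub>C\<close> are the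
  sums of the left factors) eliminates \<open>c\<^sub>j\<close> and leaves an affine function of
  \<open>p\<^sub>j = (a\<^sub>j, b\<^sub>j) / \<sigma>\<^sub>j\<close>.\<close>
lemma three_term_affine_representation:
  fixes A B C a b c :: "nat \<Rightarrow> real"
  assumes X: "X \<in> carrier_mat m n" "nonneg_mat X"
    and fac: "\<And>r j. r < m \<Longrightarrow> j < n \<Longrightarrow> X $$ (r, j) = A r * a j + B r * b j + C r * c j"
    and sums: "(\<Sum>r<m. C r) = 0 \<Longrightarrow> (\<Sum>r<m. A r) = 0 \<and> (\<Sum>r<m. B r) = 0"
  obtains \<sigma> :: "nat \<Rightarrow> real" and p g :: "nat \<Rightarrow> real^2" and h :: "nat \<Rightarrow> real"
  where "\<And>j. j < n \<Longrightarrow> 0 \<le> \<sigma> j"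
    "\<And>r j. r < m \<Longrightarrow> j < n \<Longrightarrow> X $$ (r, j) = \<sigma> j * (g r \<bullet> p j + h r)"
proof -
  define sA sB sC where "sA = (\<Sum>r<m. A r)" "sB = (\<Sum>r<m. B r)" "sC = (\<Sum>r<m. C r)"
  define \<sigma> where "\<sigma> j = sA * a j + sB * b j + sC * c j" for j
  have \<sigma>_sum: "\<sigma> j = (\<Sum>r<m. X $$ (r, j))" if "j < n" for j
    using that by (simp add: fac sum.distrib sum_distrib_right \<sigma>_def sA_sB_sC_def)
  have X0: "0 \<le> X $$ (r, j)" if "r < m" "j < n" for r j
    using X that by (simp add: nonneg_mat_def)
  define p :: "nat \<Rightarrow> real^2" where "p j = vector [a j / \<sigma> j, b j / \<sigma> j]" for j
  define g :: "nat \<Rightarrow> real^2" where "g r = vector [A r - C r * sA / sC, B r - C r * sB / sC]" for r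
  define h where "h r = C r / sC" for r
  have "X $$ (r, j) = \<sigma> j * (g r \<bullet> p j + h r)" if r: "r < m" and j: "j < n" for r j
  proof (cases "\<sigma> j = 0")
    case True
    then have "X $$ (r, j) = 0"
      using \<sigma>_sum[OF j] X0 j sum_nonneg_eq_0_iff[of "{..<m}" "\<lambda>r. X $$ (r, j)"] r by auto
    with True show ?thesis by simp
  next
    case False
    then have "sC \<noteq> 0" using sums by (auto simp: \<sigma>_def sA_sB_sC_def)
    have "\<sigma> j * (g r \<bullet> p j + h r) =
        \<sigma> j * ((A r - C r * sA / sC) * (a j / \<sigma> j) + (B r - C r * sB / sC) * (b j / \<sigma> j) + C r / sC)"
      by (simp add: g_def p_def h_def inner_vec_def sum_2)
    also have "\<dots> = A r * a j + B r * b j + C r * (\<sigma> j - sA * a j - sB * b j) / sC"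
      using False \<open>sC \<noteq> 0\<close> by (simp add: field_simps)
    also have "\<dots> = X $$ (r, j)" using \<open>sC \<noteq> 0\<close> fac[OF r j] by (simp add: \<sigma>_def)
    finally show ?thesis by simp
  qed
  moreover have "0 \<le> \<sigma> j" if "j < n" for j
    unfolding \<sigma>_sum[OF that] using X0 that by (intro sum_nonneg) auto
  ultimately show ?thesis using that by blast
qed

text \<open>The representation needs a coordinate whose left factors do not sum to zero; if every
  coordinate sums to zero, all columns of \<open>X\<close> vanish and any coordinate serves.\<close>
lemma rank3_affine_representation:
  fixes U V :: "nat \<Rightarrow> nat \<Rightarrow> real"
  assumes X: "X \<in> carrier_mat m n" "nonneg_mat X"
    and fac: "\<And>r j. r < m \<Longrightarrow> j < n \<Longrightarrow> X $$ (r, j) = (\<Sum>t<3. U r t * V t j)"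
  obtains \<sigma> :: "nat \<Rightarrow> real" and p g :: "nat \<Rightarrow> real^2" and h :: "nat \<Rightarrow> real"
  where "\<And>j. j < n \<Longrightarrow> 0 \<le> \<sigma> j"
    "\<And>r j. r < m \<Longrightarrow> j < n \<Longrightarrow> X $$ (r, j) = \<sigma> j * (g r \<bullet> p j + h r)"
proof -
  define s where "s t = (\<Sum>r<m. U r t)" for t
  have "\<exists>c<3. s c = 0 \<longrightarrow> (\<forall>t<3. s t = 0)"
    by (cases "\<exists>c<3. s c \<noteq> 0") (auto intro: exI[of _ 0])
  then obtain c where c: "c < 3" "s c = 0 \<Longrightarrow> \<forall>t<3. s t = 0" by blast
  define a b where "a = (c + 1) mod 3" "b = (c + 2) mod 3"
  show ?thesis
  proof (rule three_term_affine_representation[OF X])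
    fix r j assume "r < m" "j < n"
    show "X $$ (r, j) = U r a * V a j + U r b * V b j + U r c * V c j"
      unfolding fac[OF \<open>r < m\<close> \<open>j < n\<close>] sum_lessThan_3_rotate[OF c(1)] a_b_def ..
  next
    assume "(\<Sum>r<m. U r c) = 0"
    then show "(\<Sum>r<m. U r a) = 0 \<and> (\<Sum>r<m. U r b) = 0"
      using c by (simp add: s_def a_b_def)
  qed (rule that)
qed

lemma nonneg_rank_rank3_le:
  fixes U V :: "nat \<Rightarrow> nat \<Rightarrow> real"
  assumes \<beta>: "polygon_slack_rank_bound \<beta>" "mono \<beta>" "\<And>k. k \<le> 2 \<Longrightarrow> int k \<le> \<beta> k"
    and X: "X \<in> carrier_mat m n" "nonneg_mat X"
    and fac: "\<And>r j. r < m \<Longrightarrow> j < n \<Longrightarrow> X $$ (r, j) = (\<Sum>t<3. U r t * V t j)"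
  shows "int (nonneg_rank X) \<le> \<beta> n"
proof (rule rank3_affine_representation[OF X fac])
  fix \<sigma> :: "nat \<Rightarrow> real" and p g :: "nat \<Rightarrow> real^2" and h :: "nat \<Rightarrow> real"
  assume "\<And>j. j < n \<Longrightarrow> 0 \<le> \<sigma> j"
    and "\<And>r j. r < m \<Longrightarrow> j < n \<Longrightarrow> X $$ (r, j) = \<sigma> j * (g r \<bullet> p j + h r)"
  then show ?thesis by (intro nonneg_rank_affine_representation_le[OF \<beta> X])
qed

theorem mainTheorem1:
  assumes hyp: "\<forall>n::nat. n \<ge> 3 \<longrightarrow> (\<forall>v. convex_polygon_vertices n v \<longrightarrow>
      (\<forall>m a b. facet_description (convex hull (v ` {..<n})) m a b \<longrightarrow>
         int (nonneg_rank (slack_matrix m n a b v)) \<le> \<lfloor>(real n + 6) / 2\<rfloor>))"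
  shows "\<forall>(m::nat) (n::nat) (X::real mat). X \<in> carrier_mat m n \<longrightarrow> nonneg_mat X \<longrightarrow>
      real_rank X = 3 \<longrightarrow> int (nonneg_rank X) \<le> \<lfloor>(real (min m n) + 6) / 2\<rfloor>"
proof (intro allI impI)
  fix m n :: nat and X :: "real mat"
  assume X: "X \<in> carrier_mat m n" "nonneg_mat X" and "real_rank X = 3"
  define \<beta> :: "nat \<Rightarrow> int" where "\<beta> k = \<lfloor>(real k + 6) / 2\<rfloor>" for k
  have \<beta>_bound: "polygon_slack_rank_bound \<beta>"
    using hyp unfolding polygon_slack_rank_bound_def \<beta>_def .
  have \<beta>_mono: "mono \<beta>" unfolding \<beta>_def by (intro monoI floor_mono) (simp add: divide_right_mono)
  have \<beta>_small: "int k \<le> \<beta> k" if "k \<le> 2" for k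
    unfolding \<beta>_def using that by (simp add: le_floor_iff)
  note \<beta> = \<beta>_bound \<beta>_mono \<beta>_small
  have rk: "vec_space.rank m X = 3" using \<open>real_rank X = 3\<close> X(1) by (simp add: real_rank_def)
  obtain U V :: "nat \<Rightarrow> nat \<Rightarrow> real"
    where "\<forall>r<m. \<forall>j<n. X $$ (r, j) = (\<Sum>t<3. U r t * V t j)"
    using rank_factorization[OF X(1)] unfolding rk by blast
  then have fac: "\<And>r j. r < m \<Longrightarrow> j < n \<Longrightarrow> X $$ (r, j) = (\<Sum>t<3. U r t * V t j)" by blast
  have "int (nonneg_rank X) \<le> \<beta> n" by (rule nonneg_rank_rank3_le[OF \<beta> X fac])
  moreover have "int (nonneg_rank (transpose_mat X)) \<le> \<beta> m"
  proof (rule nonneg_rank_rank3_le[OF \<beta>])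
    show "transpose_mat X \<in> carrier_mat n m" "nonneg_mat (transpose_mat X)" using X by auto
    show "transpose_mat X $$ (j, r) = (\<Sum>t<3. V t j * U r t)" if "j < n" "r < m" for j r
      using fac[OF that(2,1)] that X(1) by (simp add: mult.commute)
  qed
  ultimately show "int (nonneg_rank X) \<le> \<lfloor>(real (min m n) + 6) / 2\<rfloor>"
    using nonneg_rank_transpose[OF X(2)] by (simp add: \<beta>_def min_def)
qed

end
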